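(* Let $\overline K$ be an algebraically closed field and let $\mathcal L=\{L_1,\dots,L_s\}$ be a set of $s\ge3$ skew lines in $\mathbb P^3_{\overline K}$. The groupoid $C_{\mathcal L}$ has an infinite orbit if and only if $|G_{\mathcal L}|=\infty$, in which case all but at most two orbits are infinite, and the finite orbits, if any, have order $s$ and come from transversals for $\mathcal L$ (i.e. each is of the form $T\cap(\bigcup_iL_i)$ for a transversal $T$ for $\mathcal L$).
   Context: For distinct $i,j,k$ let $f_{ijk}\colon L_i\to L_j$ be the linear isomorphism sending $p\in L_i$ to the point where the plane spanned by $p$ and $L_k$ meets $L_j$. The groupoid $C_{\mathcal L}$ has the lines $L_i$ as objects and all possible compositions of the maps $f_{ijk}$ as arrows. The groups $G_i=\mathrm{Hom}_{C_{\mathcal L}}(L_i,L_i)$ are all isomorphic, and $G_{\mathcal L}$ denotes any of them. For $p\in L_i$, its orbit is $[p]=\bigcup_j\{g(p):g\in\mathrm{Hom}_{C_{\mathcal L}}(L_i,L_j)\}$. A transversal for $\mathcal L$ is a line meeting every line of $\mathcal L$. *)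

theory Defs
  imports "HOL-Analysis.Analysis" "HOL-Computational_Algebra.Computational_Algebra" "HOL-Algebra.Group"
begin

(* Projective 3-space over a field 'a: a point is a one-dimensional linear subspace of 'a^4,
   and every projective linear subspace is given as its set of points. *)

type_synonym 'a point = "('a ^ 4) set"

definition points :: "'a::field point set" where
  "points = {p. vec.subspace p \<and> vec.dim p = 1}"

definition proj_lines :: "'a::field point set set" where
  "proj_lines = {{p \<in> points. p \<subseteq> V} | V. vec.subspace V \<and> vec.dim V = 2}"

definition proj_span :: "'a::field point set \<Rightarrow> 'a point set" where
  "proj_span S = {q \<in> points. q \<subseteq> vec.span (\<Union> S)}"

definition skew_lines :: "'a::field point set set \<Rightarrow> bool" where
  "skew_lines \<L> \<longleftrightarrow> \<L> \<subseteq> proj_lines \<and> pairwise disjnt \<L>"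

(* The lines of \<L> serve as their own indices: proj_map Li Lj Lk is the map f_ijk.
   For pairwise skew Li, Lj, Lk and p in Li the plane spanned by p and Lk meets Lj in
   exactly one point, so the description is proper. Maps are restricted to their source line
   (undefined outside it), so that two arrows are equal iff they agree on the source. *)

definition proj_map :: "'a::field point set \<Rightarrow> 'a point set \<Rightarrow> 'a point set \<Rightarrow> 'a point \<Rightarrow> 'a point" where
  "proj_map Li Lj Lk = (\<lambda>p\<in>Li. THE q. q \<in> Lj \<and> q \<in> proj_span (insert p Lk))"

(* The empty composition is included. Closure under inverses needs no rule of its own, since
   proj_map Lj Li Lk is the inverse of proj_map Li Lj Lk. *)

inductive arrow :: "'a::field point set set \<Rightarrow> 'a point set \<Rightarrow> 'a point set \<Rightarrow> ('a point \<Rightarrow> 'a point) \<Rightarrow> bool"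
  for \<L> where
  identity: "L \<in> \<L> \<Longrightarrow> arrow \<L> L L (\<lambda>p\<in>L. p)"
| generator: "\<lbrakk>Li \<in> \<L>; Lj \<in> \<L>; Lk \<in> \<L>; Li \<noteq> Lj; Lj \<noteq> Lk; Li \<noteq> Lk\<rbrakk>
    \<Longrightarrow> arrow \<L> Li Lj (proj_map Li Lj Lk)"
| composition: "\<lbrakk>arrow \<L> L M g; arrow \<L> M N h\<rbrakk> \<Longrightarrow> arrow \<L> L N (compose L h g)"

definition Hom :: "'a::field point set set \<Rightarrow> 'a point set \<Rightarrow> 'a point set \<Rightarrow> ('a point \<Rightarrow> 'a point) set" where
  "Hom \<L> L M = {g. arrow \<L> L M g}"

definition vertex_group :: "'a::field point set set \<Rightarrow> 'a point set \<Rightarrow> ('a point \<Rightarrow> 'a point) monoid" where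
  "vertex_group \<L> L = \<lparr>carrier = Hom \<L> L L, mult = compose L, one = (\<lambda>p\<in>L. p)\<rparr>"

definition orbit :: "'a::field point set set \<Rightarrow> 'a point set \<Rightarrow> 'a point \<Rightarrow> 'a point set" where
  "orbit \<L> L p = (\<Union>M\<in>\<L>. {g p | g. g \<in> Hom \<L> L M})"

definition orbits :: "'a::field point set set \<Rightarrow> 'a point set set" where
  "orbits \<L> = {orbit \<L> L p | L p. L \<in> \<L> \<and> p \<in> L}"

definition transversal :: "'a::field point set set \<Rightarrow> 'a point set \<Rightarrow> bool" where
  "transversal \<L> T \<longleftrightarrow> T \<in> proj_lines \<and> (\<forall>L\<in>\<L>. T \<inter> L \<noteq> {})"

end

(*
  Let U_i be the 2-dimensional space of vectors of L_i. The map f_ijk is induced by the linear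
  projection of U_i onto U_j along U_k, so an arrow is determined by its values at three points of
  its source. Hence, if some vertex group is infinite, at most two points of each line have a
  finite orbit. If p = <v> on L_1 is such a point, split v = x + y with x in U_2 and y in U_4 and
  project the summands to U_1 along U_3: this gives v = a + a', where <a> and <a'> again lie in the
  orbit of p. Three pairwise distinct points are impossible, so <a> = p, which means
  f_124 p = f_123 p. Thus f_1jk p does not depend on k, and the line joining p to <x> is a
  transversal through p, along which all the f_ijk move p.
*)

theory Submission
  imports Defs
begin

section \<open>Points and lines as subspaces\<close>

lemma span_singleton_in_points:
  fixes v :: "'a::field ^ 4"
  assumes "v \<noteq> 0"
  shows "vec.span {v} \<in> points"
  using assms by (simp add: points_def)

lemma pointE:
  fixes p :: "'a::field point"
  assumes "p \<in> points"
  obtains v where "v \<noteq> 0" "p = vec.span {v}"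
proof -
  from assms have p: "vec.subspace p" "vec.dim p = 1" by (auto simp: points_def)
  obtain B where B: "B \<subseteq> p" "vec.independent B" "p \<subseteq> vec.span B" "card B = vec.dim p"
    using vec.basis_exists by blast
  then obtain v where "B = {v}" using p(2) by (metis card_1_singletonE)
  moreover have "p = vec.span B" using B p(1) by (simp add: vec.span_minimal subset_antisym)
  ultimately show thesis using B(2) that[of v] vec.dependent_zero by blast
qed

lemma span_singleton_eqI:
  fixes v w :: "'a::field ^ 4"
  assumes "w \<noteq> 0" "w = c *s v"
  shows "vec.span {w} = vec.span {v}"
proof
  show "vec.span {w} \<subseteq> vec.span {v}"
    using assms by (intro vec.span_minimal) (auto intro: vec.span_scale vec.span_base)
  have "c \<noteq> 0" using assms by auto
  then have "v = inverse c *s w" using assms by (simp add: vector_smult_assoc)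
  then show "vec.span {v} \<subseteq> vec.span {w}"
    by (intro vec.span_minimal) (auto intro: vec.span_scale vec.span_base)
qed

lemma span_singleton_eqE:
  fixes v w :: "'a::field ^ 4"
  assumes "vec.span {w} = vec.span {v}"
  obtains c where "w = c *s v"
proof -
  have "w \<in> vec.span {v}" using assms vec.span_base[of w "{w}"] by simp
  then show thesis using that by (auto simp: vec.span_singleton)
qed

lemma notin_span_singleton:
  fixes u v :: "'a::field ^ 4"
  assumes "u \<noteq> 0" "vec.span {u} \<noteq> vec.span {v}"
  shows "u \<notin> vec.span {v}"
proof
  assume "u \<in> vec.span {v}"
  then obtain c where "u = c *s v" by (auto simp: vec.span_singleton)
  then show False using span_singleton_eqI assms by blast
qed

text \<open>Points are themselves sets of vectors, so the union recovers the plane of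
  \<open>'a ^ 4\<close> underlying a line without choosing a witness from
  \<open>proj_lines\<close>.\<close>

definition vectors :: "'a::field point set \<Rightarrow> ('a ^ 4) set" where
  "vectors L = \<Union>L"

lemma proj_lineE:
  fixes L :: "'a::field point set"
  assumes "L \<in> proj_lines"
  obtains "vec.subspace (vectors L)" "vec.dim (vectors L) = 2" "L = {p \<in> points. p \<subseteq> vectors L}"
proof -
  obtain V where V: "vec.subspace V" "vec.dim V = 2" "L = {p \<in> points. p \<subseteq> V}"
    using assms by (auto simp: proj_lines_def)
  have in_vectors: "v \<in> vectors L" if "v \<in> V" "v \<noteq> 0" for v
    unfolding vectors_def
  proof
    show "v \<in> vec.span {v}" by (simp add: vec.span_base)
    show "vec.span {v} \<in> L"
      using that V by (simp add: span_singleton_in_points vec.span_minimal)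
  qed
  \<comment> \<open>The zero vector lies in every point, yet it reaches the union only if
    \<open>L\<close> is nonempty; a nonzero \<open>w\<close> provides such a point.\<close>
  obtain w where w: "w \<in> V" "w \<noteq> 0"
    using V(2) vec.dim_eq_0[of V] by fastforce
  have "0 \<in> vec.span {w}" by (rule vec.span_zero)
  moreover have "vec.span {w} \<in> L"
    using w V by (simp add: span_singleton_in_points vec.span_minimal)
  ultimately have "0 \<in> vectors L" by (auto simp: vectors_def)
  then have "V \<subseteq> vectors L" using in_vectors by blast
  moreover have "vectors L \<subseteq> V" using V(3) by (auto simp: vectors_def)
  ultimately have "vectors L = V" by simp
  with V show thesis using that by simp
qed

lemma line_subspace: "L \<in> proj_lines \<Longrightarrow> vec.subspace (vectors L)"
  by (rule proj_lineE)

lemma line_dim: "L \<in> proj_lines \<Longrightarrow> vec.dim (vectors L) = 2"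
  by (rule proj_lineE)

lemma in_line_iff: "L \<in> proj_lines \<Longrightarrow> p \<in> L \<longleftrightarrow> p \<in> points \<and> p \<subseteq> vectors L"
  by (erule proj_lineE) blast

lemma span_singleton_in_line_iff:
  fixes v :: "'a::field ^ 4"
  assumes "L \<in> proj_lines" "v \<noteq> 0"
  shows "vec.span {v} \<in> L \<longleftrightarrow> v \<in> vectors L"
proof
  show "v \<in> vectors L" if "vec.span {v} \<in> L" using that vec.span_base[of v "{v}"] by (auto simp: vectors_def)
  show "vec.span {v} \<in> L" if "v \<in> vectors L"
    using that assms vec.span_minimal[of "{v}" "vectors L"]
    by (simp add: in_line_iff span_singleton_in_points line_subspace)
qed

lemma line_pointE:
  fixes p :: "'a::field point"
  assumes "L \<in> proj_lines" "p \<in> L"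
  obtains v where "v \<noteq> 0" "v \<in> vectors L" "p = vec.span {v}"
proof -
  have "p \<in> points" using assms in_line_iff by blast
  then obtain v where "v \<noteq> 0" "p = vec.span {v}" by (rule pointE)
  then show thesis using that assms span_singleton_in_line_iff by blast
qed

lemma line_spanned_by_two_points:
  fixes u v :: "'a::field ^ 4"
  assumes L: "L \<in> proj_lines" and u: "u \<noteq> 0" "u \<in> vectors L" and v: "v \<noteq> 0" "v \<in> vectors L"
    and ne: "vec.span {u} \<noteq> vec.span {v}" and w: "w \<in> vectors L"
  obtains a b where "w = a *s u + b *s v"
proof -
  obtain U: "vec.subspace (vectors L)" "vec.dim (vectors L) = 2" by (rule proj_lineE[OF L])
  have "u \<notin> vec.span {v}"
    using ne u(1) by (rule notin_span_singleton[rotated])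
  then have "vec.independent {u, v}" and "u \<noteq> v"
    using v ne by (auto simp: vec.independent_insert vec.dim_insert)
  then have "vec.dim (vec.span {u, v}) = 2"
    by (subst vec.dim_span_eq_card_independent) auto
  then have "vec.span {u, v} = vectors L"
    using U u(2) v(2) by (intro vec.subspace_dim_equal vec.span_minimal) simp_all
  then obtain a where "w - a *s u \<in> vec.span {v}"
    using w vec.span_breakdown_eq[of w u "{v}"] by blast
  then obtain b where "w - a *s u = b *s v" by (auto simp: vec.span_singleton)
  then have "w = a *s u + b *s v" by (metis add.commute diff_add_cancel)
  then show thesis by (rule that)
qed

lemma line_through_two_points:
  fixes u v :: "'a::field ^ 4"
  assumes u: "u \<noteq> 0" and v: "v \<noteq> 0" and ne: "vec.span {u} \<noteq> vec.span {v}"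
  obtains T where "T \<in> proj_lines" "vec.span {u} \<in> T" "vec.span {v} \<in> T"
    "vectors T = vec.span {u, v}"
proof -
  have "u \<notin> vec.span {v}"
    using ne u by (rule notin_span_singleton[rotated])
  then have "vec.dim {u, v} = 2" using v by (simp add: vec.dim_insert)
  define T where "T = {p \<in> points. p \<subseteq> vec.span {u, v}}"
  have T: "T \<in> proj_lines"
    using \<open>vec.dim {u, v} = 2\<close> unfolding proj_lines_def T_def
    by (intro CollectI exI[of _ "vec.span {u, v}"]) simp
  have in_T: "vec.span {w} \<in> T" if "w \<noteq> 0" "w \<in> vec.span {u, v}" for w
    using that by (simp add: T_def span_singleton_in_points vec.span_minimal)
  have "vectors T = vec.span {u, v}"
  proof
    show "vectors T \<subseteq> vec.span {u, v}" by (auto simp: T_def vectors_def)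
    show "vec.span {u, v} \<subseteq> vectors T"
      using in_T u v span_singleton_in_line_iff[OF T] line_subspace[OF T]
      by (intro vec.span_minimal) (auto simp: vec.span_base)
  qed
  then show thesis using that T in_T u v by (simp add: vec.span_base)
qed

text \<open>Representatives of \<open>p\<close> and \<open>q\<close> span the plane underlying
  either line. This is what lets a transversal meet each line only once.\<close>

lemma line_eq_if_two_common_points:
  fixes p q :: "'a::field point"
  assumes L: "L \<in> proj_lines" "p \<in> L" "q \<in> L" and T: "T \<in> proj_lines" "p \<in> T" "q \<in> T"
    and ne: "p \<noteq> q"
  shows "L = T"
proof -
  obtain u where u: "u \<noteq> 0" "u \<in> vectors L" "p = vec.span {u}"
    by (rule line_pointE[OF L(1,2)])
  obtain v where v: "v \<noteq> 0" "v \<in> vectors L" "q = vec.span {v}"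
    by (rule line_pointE[OF L(1,3)])
  have uv: "u \<in> vectors T" "v \<in> vectors T"
    using u v T span_singleton_in_line_iff by blast+
  have sub: "vectors M \<subseteq> vec.span {u, v}"
    if M: "M \<in> proj_lines" and uM: "u \<in> vectors M" and vM: "v \<in> vectors M" for M
  proof
    fix w assume "w \<in> vectors M"
    obtain a b where "w = a *s u + b *s v"
      using line_spanned_by_two_points[OF M u(1) _ v(1) _ _ \<open>w \<in> vectors M\<close>] uM vM u(3) v(3) ne
      by metis
    then show "w \<in> vec.span {u, v}"
      by (auto intro!: vec.span_add vec.span_scale intro: vec.span_base)
  qed
  have span: "vectors M = vec.span {u, v}"
    if "M \<in> proj_lines" "u \<in> vectors M" "v \<in> vectors M" for M
  proof
    show "vec.span {u, v} \<subseteq> vectors M"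
      using that line_subspace by (intro vec.span_minimal) auto
  qed (rule sub[OF that])
  have "r \<in> L \<longleftrightarrow> r \<in> T" for r
    using span[OF L(1) u(2) v(2)] span[OF T(1) uv] in_line_iff[OF L(1)] in_line_iff[OF T(1)] by simp
  then show ?thesis by blast
qed

section \<open>The maps of the groupoid as projections\<close>

text \<open>This makes \<open>g\<close> a projectivity on \<open>L\<close>. Nothing is asked of
  \<open>\<phi>\<close> off \<open>vectors L\<close>, and there it is injective because it is linear
  with trivial kernel.\<close>

definition induced_by :: "'a::field point set \<Rightarrow> ('a point \<Rightarrow> 'a point) \<Rightarrow> ('a ^ 4 \<Rightarrow> 'a ^ 4) \<Rightarrow> bool" where
  "induced_by L g \<phi> \<longleftrightarrow>
    (\<forall>u\<in>vectors L. \<forall>v\<in>vectors L. \<forall>a b. \<phi> (a *s u + b *s v) = a *s \<phi> u + b *s \<phi> v) \<and>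
    (\<forall>v\<in>vectors L. v \<noteq> 0 \<longrightarrow> \<phi> v \<noteq> 0 \<and> g (vec.span {v}) = vec.span {\<phi> v})"

lemma induced_by_linear:
  "\<lbrakk>induced_by L g \<phi>; u \<in> vectors L; v \<in> vectors L\<rbrakk> \<Longrightarrow> \<phi> (a *s u + b *s v) = a *s \<phi> u + b *s \<phi> v"
  unfolding induced_by_def by blast

lemma induced_by_span:
  "\<lbrakk>induced_by L g \<phi>; v \<in> vectors L; v \<noteq> 0\<rbrakk> \<Longrightarrow> \<phi> v \<noteq> 0 \<and> g (vec.span {v}) = vec.span {\<phi> v}"
  unfolding induced_by_def by blast

lemma induced_by_maps:
  assumes "induced_by L g \<phi>" "M \<in> proj_lines" "\<And>p. p \<in> L \<Longrightarrow> g p \<in> M" "L \<in> proj_lines" "v \<in> vectors L"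
  shows "\<phi> v \<in> vectors M"
proof (cases "v = 0")
  case True
  then have "\<phi> v = 0" using induced_by_linear[OF assms(1,5,5), of 0 0] by simp
  then show ?thesis using vec.subspace_0[OF line_subspace[OF assms(2)]] True by (simp only:)
next
  case False
  then have "\<phi> v \<noteq> 0" "vec.span {\<phi> v} \<in> M"
    using assms induced_by_span span_singleton_in_line_iff by metis+
  then show ?thesis using assms(2) span_singleton_in_line_iff by blast
qed

text \<open>Uniqueness in the fundamental theorem for a projective line: agreement at a point means
  that the two linear maps differ there by a scalar, and a third point that combines the first two
  forces all these scalars to coincide. Then \<open>\<phi>\<close> is a multiple of
  \<open>\<psi>\<close> on all of \<open>vectors L\<close>.\<close>

lemma induced_by_eq_if_three_points:
  fixes g h :: "'a::field point \<Rightarrow> 'a point"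
  assumes L: "L \<in> proj_lines" and g: "induced_by L g \<phi>" and h: "induced_by L h \<psi>"
    and pts: "p \<in> L" "q \<in> L" "r \<in> L" "p \<noteq> q" "p \<noteq> r" "q \<noteq> r"
    and eq: "g p = h p" "g q = h q" "g r = h r" and x: "x \<in> L"
  shows "g x = h x"
proof -
  obtain u where u: "u \<noteq> 0" "u \<in> vectors L" "p = vec.span {u}"
    by (rule line_pointE[OF L pts(1)])
  obtain v where v: "v \<noteq> 0" "v \<in> vectors L" "q = vec.span {v}"
    by (rule line_pointE[OF L pts(2)])
  obtain w where w: "w \<noteq> 0" "w \<in> vectors L" "r = vec.span {w}"
    by (rule line_pointE[OF L pts(3)])
  obtain y where y: "y \<noteq> 0" "y \<in> vectors L" "x = vec.span {y}"
    by (rule line_pointE[OF L x])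
  obtain a b where ab: "w = a *s u + b *s v"
    using line_spanned_by_two_points[OF L u(1,2) v(1,2) _ w(2)] u v pts by metis
  \<comment> \<open>A zero coefficient would make \<open>r\<close> equal to \<open>p\<close> or
    \<open>q\<close>.\<close>
  have "a \<noteq> 0" "b \<noteq> 0"
    using ab w(1) w(3) u(3) v(3) pts span_singleton_eqI[of w b v] span_singleton_eqI[of w a u] by auto
  obtain cu where cu: "\<phi> u = cu *s \<psi> u"
    using eq(1) u induced_by_span[OF g u(2,1)] induced_by_span[OF h u(2,1)] span_singleton_eqE by metis
  obtain cv where cv: "\<phi> v = cv *s \<psi> v"
    using eq(2) v induced_by_span[OF g v(2,1)] induced_by_span[OF h v(2,1)] span_singleton_eqE by metis
  obtain cw where cw: "\<phi> w = cw *s \<psi> w"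
    using eq(3) w induced_by_span[OF g w(2,1)] induced_by_span[OF h w(2,1)] span_singleton_eqE by metis
  have "a *s \<phi> u + b *s \<phi> v = cw *s (a *s \<psi> u + b *s \<psi> v)"
    using cw ab induced_by_linear[OF g u(2) v(2)] induced_by_linear[OF h u(2) v(2)] by simp
  \<comment> \<open>The relation between images is pulled back to one between \<open>u\<close> and
    \<open>v\<close> by the injectivity of \<open>\<psi>\<close>; independence of \<open>u\<close>
    and \<open>v\<close> then kills both coefficients.\<close>
  then have "\<psi> ((a * (cu - cw)) *s u + (b * (cv - cw)) *s v) = 0"
    unfolding induced_by_linear[OF h u(2) v(2)] cu cv
    by (simp add: vec_eq_iff algebra_simps)
  moreover have "(a * (cu - cw)) *s u + (b * (cv - cw)) *s v \<in> vectors L"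
    using line_subspace[OF L] u(2) v(2) by (intro vec.subspace_add vec.subspace_scale)
  ultimately have z: "(a * (cu - cw)) *s u + (b * (cv - cw)) *s v = 0"
    using induced_by_span[OF h] by blast
  have "b * (cv - cw) = 0"
  proof (rule ccontr)
    assume "b * (cv - cw) \<noteq> 0"
    then have "v = (- (a * (cu - cw)) / (b * (cv - cw))) *s u"
      using z by (simp add: vec_eq_iff field_simps add_eq_0_iff)
    then show False using span_singleton_eqI[OF v(1)] u v pts by metis
  qed
  moreover from this have "(a * (cu - cw)) *s u = 0" using z by (simp only: vector_smult_lzero add_0_right)
  then have "a * (cu - cw) = 0" using u(1) by (simp only: vector_mul_eq_0) simp
  ultimately have c: "cu = cw" "cv = cw" using \<open>a \<noteq> 0\<close> \<open>b \<noteq> 0\<close> by auto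
  obtain \<alpha> \<beta> where "y = \<alpha> *s u + \<beta> *s v"
    using line_spanned_by_two_points[OF L u(1,2) v(1,2) _ y(2)] u v pts by metis
  then have "\<phi> y = cw *s \<psi> y"
    using induced_by_linear[OF g u(2) v(2), of \<alpha> \<beta>] induced_by_linear[OF h u(2) v(2), of \<alpha> \<beta>]
    by (simp only: cu cv c) (simp add: vec_eq_iff algebra_simps)
  then show ?thesis
    using y induced_by_span[OF g y(2,1)] induced_by_span[OF h y(2,1)] span_singleton_eqI by metis
qed


section \<open>Orbits of a configuration of skew lines\<close>

locale skew_line_configuration =
  fixes \<L> :: "'a::field point set set"
  assumes finite_lines: "finite \<L>" and three_lines: "card \<L> \<ge> 3" and skew: "skew_lines \<L>"
begin

lemma line: "L \<in> \<L> \<Longrightarrow> L \<in> proj_lines"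
  using skew by (auto simp: skew_lines_def)

lemma lines_disjoint: "\<lbrakk>L \<in> \<L>; M \<in> \<L>; p \<in> L; p \<in> M\<rbrakk> \<Longrightarrow> L = M"
  using skew by (auto simp: skew_lines_def pairwise_def disjnt_iff)

section \<open>Skew lines as complementary planes, and the generators as linear projections\<close>

lemma zero_if_common:
  assumes "L \<in> \<L>" "M \<in> \<L>" "L \<noteq> M" "v \<in> vectors L" "v \<in> vectors M"
  shows "v = 0"
proof (rule ccontr)
  assume "v \<noteq> 0"
  then have "vec.span {v} \<in> L" "vec.span {v} \<in> M"
    using assms line span_singleton_in_line_iff by blast+
  then show False using assms lines_disjoint by blast
qed

lemma another_line:
  assumes "finite S" "card S < 3"
  obtains K where "K \<in> \<L>" "K \<notin> S"
proof -
  have "\<not> \<L> \<subseteq> S"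
    using card_mono[OF assms(1), of \<L>] assms(2) three_lines by linarith
  then show thesis using that by blast
qed

text \<open>The planes of two skew lines meet only in 0, so their sum has dimension 2 + 2 = 4 and
  fills the whole space.\<close>

lemma decomposition:
  assumes L: "L \<in> \<L>" and M: "M \<in> \<L>" and ne: "L \<noteq> M"
  obtains a b where "a \<in> vectors L" "b \<in> vectors M" "v = a + b"
proof -
  let ?S = "{x + y |x y. x \<in> vectors L \<and> y \<in> vectors M}"
  have sub: "vec.subspace (vectors L)" "vec.subspace (vectors M)"
    using L M line line_subspace by blast+
  have "vectors L \<inter> vectors M = {0}"
    using zero_if_common[OF L M ne] sub[THEN vec.subspace_0] by blast
  moreover have "vec.dim (vectors L) = 2" "vec.dim (vectors M) = 2"
    using L M line line_dim by blast+
  ultimately have "vec.dim ?S = 4"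
    using vec.dim_sums_Int[OF sub] by simp
  moreover have "vec.dim (UNIV :: ('a ^ 4) set) = 4" by (simp only: vec_dim_card) simp
  ultimately have "?S = UNIV"
    using vec.subspace_sums[OF sub] by (intro vec.subspace_dim_equal) (simp_all del: vec.dim_UNIV)
  then have "v \<in> ?S" by simp
  then show thesis using that by blast
qed

lemma decomposition_unique:
  assumes L: "L \<in> \<L>" and M: "M \<in> \<L>" and ne: "L \<noteq> M"
    and "a \<in> vectors L" "b \<in> vectors M" "c \<in> vectors L" "d \<in> vectors M" and eq: "a + b = c + d"
  shows "a = c" "b = d"
proof -
  have sub: "vec.subspace (vectors L)" "vec.subspace (vectors M)"
    using L M line line_subspace by blast+
  have "a - c \<in> vectors L" using sub(1) assms(4,6) by (rule vec.subspace_diff)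
  moreover have "a - c = d - b" using eq by (simp add: algebra_simps)
  moreover have "d - b \<in> vectors M" using sub(2) assms(7,5) by (rule vec.subspace_diff)
  ultimately have "a - c = 0" using zero_if_common[OF L M ne] by metis
  then show "a = c" "b = d" using eq by simp_all
qed

text \<open>Translates the geometric description of the generator into linear algebra: it takes the
  \<open>Lj\<close>-component of a vector along \<open>Lk\<close>. All later computations with
  \<open>proj_map\<close> rest on this form.\<close>

lemma proj_map_span:
  assumes L: "Li \<in> \<L>" "Lj \<in> \<L>" "Lk \<in> \<L>" "Li \<noteq> Lj" "Lj \<noteq> Lk" "Li \<noteq> Lk"
    and v: "v \<noteq> 0" "v \<in> vectors Li" and ab: "v = a + b" "a \<in> vectors Lj" "b \<in> vectors Lk"
  shows "a \<noteq> 0" "proj_map Li Lj Lk (vec.span {v}) = vec.span {a}"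
proof -
  have subk: "vec.subspace (vectors Lk)" and subj: "vec.subspace (vectors Lj)"
    using L line line_subspace by blast+
  \<comment> \<open>Otherwise \<open>v = b\<close> would be a nonzero vector common to
    \<open>Li\<close> and \<open>Lk\<close>.\<close>
  show "a \<noteq> 0"
    using ab(1,3) v(1) zero_if_common[OF L(1,3,6) v(2)] by (metis add_0_left)
  have vp: "vec.span {v} \<in> Li" and ap: "vec.span {a} \<in> Lj"
    using v ab \<open>a \<noteq> 0\<close> L line span_singleton_in_line_iff by blast+
  let ?V = "vec.span (\<Union>(insert (vec.span {v}) Lk))"
  \<comment> \<open>The span is that of \<open>v\<close> together with \<open>vectors Lk\<close>, so
    membership means being a multiple of \<open>v\<close> modulo \<open>vectors Lk\<close>.\<close>
  have span: "w \<in> ?V \<longleftrightarrow> (\<exists>c. w - c *s v \<in> vectors Lk)" for w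
  proof -
    have "?V = vec.span (insert v (vectors Lk))"
    proof
      show "?V \<subseteq> vec.span (insert v (vectors Lk))"
        using vec.span_mono[of "{v}" "insert v (vectors Lk)"]
        by (intro vec.span_minimal) (auto simp: vectors_def intro: vec.span_base)
      have "v \<in> ?V" by (intro vec.span_base) (simp add: vec.span_base)
      then show "vec.span (insert v (vectors Lk)) \<subseteq> ?V"
        by (intro vec.span_minimal) (auto simp: vectors_def intro: vec.span_base)
    qed
    then show ?thesis
      using subk by (simp only: vec.span_breakdown_eq vec.span_eq_iff[THEN iffD2])
  qed
  have "a - 1 *s v \<in> vectors Lk"
    using vec.subspace_neg[OF subk ab(3)] ab(1) by simp
  then have "a \<in> ?V" using span by blast
  then have "vec.span {a} \<subseteq> ?V" by (simp add: vec.span_minimal)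
  then have 1: "vec.span {a} \<in> proj_span (insert (vec.span {v}) Lk)"
    using \<open>a \<noteq> 0\<close> by (simp add: proj_span_def span_singleton_in_points)
  have 2: "q = vec.span {a}" if q: "q \<in> Lj" "q \<in> proj_span (insert (vec.span {v}) Lk)" for q
  proof -
    obtain w where w: "w \<noteq> 0" "w \<in> vectors Lj" "q = vec.span {w}"
      by (rule line_pointE[OF line[OF L(2)] q(1)])
    have "w \<in> ?V" using q(2) w(3) vec.span_base[of w "{w}"] by (auto simp: proj_span_def)
    then obtain c where c: "w - c *s v \<in> vectors Lk" using span by auto
    \<comment> \<open>Two decompositions of \<open>w\<close> along \<open>Lj\<close> and
      \<open>Lk\<close>, the first with \<open>Lk\<close>-component 0; comparing the
      \<open>Lj\<close>-components makes \<open>w\<close> a multiple of \<open>a\<close>.\<close>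
    have "w + 0 = c *s a + (c *s b + (w - c *s v))" using ab(1) by (simp add: algebra_simps)
    moreover have "c *s b + (w - c *s v) \<in> vectors Lk"
      using subk ab(3) c by (intro vec.subspace_add vec.subspace_scale)
    ultimately have "w = c *s a"
      using decomposition_unique(1)[OF L(2,3,5) w(2) vec.subspace_0[OF subk]
          vec.subspace_scale[OF subj ab(2)]] by blast
    then show ?thesis using w span_singleton_eqI by blast
  qed
  have "(THE q. q \<in> Lj \<and> q \<in> proj_span (insert (vec.span {v}) Lk)) = vec.span {a}"
    by (rule the_equality) (use 1 ap in blast, use 2 in blast)
  then show "proj_map Li Lj Lk (vec.span {v}) = vec.span {a}"
    using vp by (simp add: proj_map_def)
qed

lemma proj_map_in:
  assumes L: "Li \<in> \<L>" "Lj \<in> \<L>" "Lk \<in> \<L>" "Li \<noteq> Lj" "Lj \<noteq> Lk" "Li \<noteq> Lk" and p: "p \<in> Li"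
  shows "proj_map Li Lj Lk p \<in> Lj"
proof -
  obtain v where v: "v \<noteq> 0" "v \<in> vectors Li" "p = vec.span {v}"
    by (rule line_pointE[OF line[OF L(1)] p])
  obtain a b where ab: "a \<in> vectors Lj" "b \<in> vectors Lk" "v = a + b"
    by (rule decomposition[OF L(2,3,5)])
  note a = proj_map_span[OF L v(1,2) ab(3,1,2)]
  then show ?thesis using v(3) ab(1) span_singleton_in_line_iff[OF line[OF L(2)] a(1)] by simp
qed

text \<open>The decomposition \<open>v = a + b\<close> read backwards is \<open>a = v + - b\<close>,
  which splits \<open>a\<close> along \<open>Li\<close> and \<open>Lk\<close>.\<close>

lemma proj_map_inverse:
  assumes L: "Li \<in> \<L>" "Lj \<in> \<L>" "Lk \<in> \<L>" "Li \<noteq> Lj" "Lj \<noteq> Lk" "Li \<noteq> Lk" and p: "p \<in> Li"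
  shows "proj_map Lj Li Lk (proj_map Li Lj Lk p) = p"
proof -
  obtain v where v: "v \<noteq> 0" "v \<in> vectors Li" "p = vec.span {v}"
    by (rule line_pointE[OF line[OF L(1)] p])
  obtain a b where ab: "a \<in> vectors Lj" "b \<in> vectors Lk" "v = a + b"
    by (rule decomposition[OF L(2,3,5)])
  note a = proj_map_span[OF L v(1,2) ab(3,1,2)]
  have "- b \<in> vectors Lk" using L(3) ab(2) line line_subspace vec.subspace_neg by blast
  moreover have "a = v + - b" using ab(3) by simp
  ultimately have "proj_map Lj Li Lk (vec.span {a}) = vec.span {v}"
    using proj_map_span(2)[OF L(2,1,3) L(4)[symmetric] L(6,5) a(1) ab(1) _ v(2)] by blast
  then show ?thesis using a(2) v(3) by simp
qed

text \<open>The component map is obtained by choice, and uniqueness of the decomposition makes it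
  linear.\<close>

lemma proj_map_induced:
  assumes L: "Li \<in> \<L>" "Lj \<in> \<L>" "Lk \<in> \<L>" "Li \<noteq> Lj" "Lj \<noteq> Lk" "Li \<noteq> Lk"
  shows "\<exists>\<phi>. induced_by Li (proj_map Li Lj Lk) \<phi>"
proof -
  have "\<forall>v. \<exists>a. a \<in> vectors Lj \<and> (\<exists>b. b \<in> vectors Lk \<and> v = a + b)"
    using decomposition[OF L(2,3,5)] by metis
  then obtain \<phi> \<psi> where dec: "\<phi> v \<in> vectors Lj" "\<psi> v \<in> vectors Lk" "v = \<phi> v + \<psi> v" for v
    by metis
  have "\<phi> (a *s u + b *s v) = a *s \<phi> u + b *s \<phi> v" for a b u v
  proof (rule decomposition_unique(1)[OF L(2,3,5) dec(1,2)])
    show "a *s \<phi> u + b *s \<phi> v \<in> vectors Lj" "a *s \<psi> u + b *s \<psi> v \<in> vectors Lk"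
      using dec L line line_subspace by (blast intro: vec.subspace_add vec.subspace_scale)+
    have "a *s u + b *s v = a *s (\<phi> u + \<psi> u) + b *s (\<phi> v + \<psi> v)"
      using dec(3)[of u] dec(3)[of v] by simp
    then show "\<phi> (a *s u + b *s v) + \<psi> (a *s u + b *s v) =
        a *s \<phi> u + b *s \<phi> v + (a *s \<psi> u + b *s \<psi> v)"
      using dec(3)[of "a *s u + b *s v"] by (simp add: algebra_simps)
  qed
  then have "induced_by Li (proj_map Li Lj Lk) \<phi>"
    using proj_map_span[OF L _ _ dec(3,1,2)] unfolding induced_by_def by blast
  then show ?thesis by blast
qed

section \<open>Arrows as invertible projectivities\<close>

lemma arrow_properties:
  assumes "arrow \<L> L M g"
  shows "L \<in> \<L> \<and> M \<in> \<L> \<and> g \<in> extensional L \<and> (\<forall>p\<in>L. g p \<in> M) \<and> (\<exists>\<phi>. induced_by L g \<phi>)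
    \<and> (\<exists>h. arrow \<L> M L h \<and> (\<forall>p\<in>L. h (g p) = p))"
  using assms
\<comment> \<open>All properties go through one induction: composing the linear maps and the
  inverses both requires that the first arrow lands in the source of the second.\<close>
proof induction
  case (identity L)
  have "induced_by L (\<lambda>p\<in>L. p) (\<lambda>v. v)"
    using span_singleton_in_line_iff[OF line[OF identity]] by (simp add: induced_by_def)
  moreover have "(\<lambda>p\<in>L. p) \<in> extensional L" "\<forall>p\<in>L. (\<lambda>p\<in>L. p) ((\<lambda>p\<in>L. p) p) = p" by simp_all
  ultimately show ?case
    using identity arrow.identity[OF identity] by (intro conjI exI ballI) (assumption | simp)+
next
  case (generator Li Lj Lk)
  have "arrow \<L> Lj Li (proj_map Lj Li Lk)" using generator by (intro arrow.generator) auto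
  moreover have "proj_map Li Lj Lk \<in> extensional Li" by (simp add: proj_map_def)
  ultimately show ?case
    using generator proj_map_in[OF generator] proj_map_inverse[OF generator]
      proj_map_induced[OF generator] by blast
next
  case (composition L M g N h)
  note IH = composition.IH
  have lines: "L \<in> \<L>" "M \<in> \<L>" "N \<in> \<L>" and maps: "\<And>p. p \<in> L \<Longrightarrow> g p \<in> M" "\<And>p. p \<in> M \<Longrightarrow> h p \<in> N"
    using IH by simp_all
  obtain \<phi> where \<phi>: "induced_by L g \<phi>" using IH(1) by metis
  obtain \<psi> where \<psi>: "induced_by M h \<psi>" using IH(2) by metis
  obtain g' where g': "arrow \<L> M L g'" "\<forall>p\<in>L. g' (g p) = p" using IH(1) by metis
  obtain h' where h': "arrow \<L> N M h'" "\<forall>p\<in>M. h' (h p) = p" using IH(2) by metis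
  have \<phi>_in: "\<phi> v \<in> vectors M" if "v \<in> vectors L" for v
    using \<phi> line[OF lines(2)] maps(1) line[OF lines(1)] that by (rule induced_by_maps)
  have "induced_by L (compose L h g) (\<psi> \<circ> \<phi>)"
    unfolding induced_by_def
  proof (intro conjI ballI allI impI)
    fix u v a b assume "u \<in> vectors L" "v \<in> vectors L"
    then show "(\<psi> \<circ> \<phi>) (a *s u + b *s v) = a *s (\<psi> \<circ> \<phi>) u + b *s (\<psi> \<circ> \<phi>) v"
      using induced_by_linear[OF \<phi>] induced_by_linear[OF \<psi>] \<phi>_in by simp
  next
    fix v assume v: "v \<in> vectors L" "v \<noteq> 0"
    note \<phi>v = induced_by_span[OF \<phi> v]
    then show "(\<psi> \<circ> \<phi>) v \<noteq> 0"
      using induced_by_span[OF \<psi> \<phi>_in[OF v(1)]] by simp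
    have "vec.span {v} \<in> L" using v span_singleton_in_line_iff[OF line[OF lines(1)]] by blast
    then show "compose L h g (vec.span {v}) = vec.span {(\<psi> \<circ> \<phi>) v}"
      using \<phi>v induced_by_span[OF \<psi> \<phi>_in[OF v(1)]] by (simp add: compose_def)
  qed
  moreover have "arrow \<L> N L (compose N g' h')" using h' g' by (blast intro: arrow.composition)
  moreover have "\<forall>p\<in>L. compose N g' h' (compose L h g p) = p" "\<forall>p\<in>L. compose L h g p \<in> N"
    using maps g' h' by (simp_all add: compose_def)
  moreover have "compose L h g \<in> extensional L" by (rule compose_extensional)
  ultimately show ?case using lines by (intro conjI exI) assumption+
qed

lemma arrow_in: "\<lbrakk>arrow \<L> L M g; p \<in> L\<rbrakk> \<Longrightarrow> g p \<in> M"
  using arrow_properties by blast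

lemma arrow_lines: "arrow \<L> L M g \<Longrightarrow> L \<in> \<L> \<and> M \<in> \<L>"
  using arrow_properties by blast

lemma arrow_inverseE:
  assumes "arrow \<L> L M g"
  obtains h where "arrow \<L> M L h" "\<And>p. p \<in> L \<Longrightarrow> h (g p) = p"
  using arrow_properties[OF assms] by blast

lemma arrow_eqI:
  assumes "arrow \<L> L M g" "arrow \<L> L M h" "\<And>p. p \<in> L \<Longrightarrow> g p = h p"
  shows "g = h"
proof (rule extensionalityI)
  show "g \<in> extensional L" "h \<in> extensional L"
    using arrow_properties[OF assms(1)] arrow_properties[OF assms(2)] by simp_all
qed (rule assms(3))

text \<open>The groupoid is connected: between two distinct lines a third one, available since there
  are at least three, yields a generator.\<close>

lemma arrow_exists:
  assumes "L \<in> \<L>" "M \<in> \<L>"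
  shows "\<exists>g. arrow \<L> L M g"
proof (cases "L = M")
  case True
  then show ?thesis using assms arrow.identity by blast
next
  case False
  obtain K where "K \<in> \<L>" "K \<notin> {L, M}"
    by (rule another_line[of "{L, M}"]) (auto simp: False)
  then have "arrow \<L> L M (proj_map L M K)" using assms False by (intro arrow.generator) auto
  then show ?thesis by blast
qed

section \<open>Orbits and their representatives\<close>

lemma in_orbit_iff: "q \<in> orbit \<L> L p \<longleftrightarrow> (\<exists>M g. arrow \<L> L M g \<and> q = g p)"
  using arrow_lines by (fastforce simp: orbit_def Hom_def)

lemma arrow_in_orbit: "arrow \<L> L M g \<Longrightarrow> g p \<in> orbit \<L> L p"
  using in_orbit_iff by blast

lemma orbit_subset:
  assumes "arrow \<L> L M g" "p \<in> L"
  shows "orbit \<L> M (g p) \<subseteq> orbit \<L> L p"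
proof
  fix r assume "r \<in> orbit \<L> M (g p)"
  then obtain N h where "arrow \<L> M N h" "r = h (g p)" by (auto simp: in_orbit_iff)
  then show "r \<in> orbit \<L> L p"
    using assms arrow.composition by (metis compose_eq in_orbit_iff)
qed

lemma orbit_eq:
  assumes g: "arrow \<L> L M g" and p: "p \<in> L"
  shows "orbit \<L> M (g p) = orbit \<L> L p"
proof -
  obtain h where h: "arrow \<L> M L h" "h (g p) = p" using g p arrow_inverseE by metis
  show ?thesis
    using orbit_subset[OF g p] orbit_subset[OF h(1) arrow_in[OF g p]] h(2) by simp
qed

text \<open>By connectedness every orbit has a representative on any prescribed line, so orbits can
  be counted on a single line.\<close>

lemma orbit_meets_line:
  assumes "X \<in> orbits \<L>" "L \<in> \<L>"
  obtains p where "p \<in> L" "X = orbit \<L> L p"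
proof -
  obtain M q where M: "M \<in> \<L>" "q \<in> M" "X = orbit \<L> M q" using assms by (auto simp: orbits_def)
  then obtain g where "arrow \<L> M L g" using arrow_exists assms by blast
  then show thesis using M that[of "g q"] arrow_in orbit_eq by metis
qed

section \<open>Finiteness of orbits against finiteness of vertex groups\<close>

lemma finite_Hom_if_three_finite_orbits:
  assumes L: "L \<in> \<L>" and pts: "p \<in> L" "q \<in> L" "r \<in> L" "p \<noteq> q" "p \<noteq> r" "q \<noteq> r"
    and fin: "finite (orbit \<L> L p)" "finite (orbit \<L> L q)" "finite (orbit \<L> L r)"
  shows "finite (Hom \<L> L L)"
proof (rule inj_on_finite)
  \<comment> \<open>A projectivity is determined by three values, and each value here ranges over a
    finite orbit.\<close>
  show "inj_on (\<lambda>g. (g p, g q, g r)) (Hom \<L> L L)"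
  proof (rule inj_onI)
    fix g h assume "g \<in> Hom \<L> L L" "h \<in> Hom \<L> L L" and eq: "(g p, g q, g r) = (h p, h q, h r)"
    then have gh: "arrow \<L> L L g" "arrow \<L> L L h" by (auto simp: Hom_def)
    then obtain \<phi> \<psi> where "induced_by L g \<phi>" "induced_by L h \<psi>" using arrow_properties by metis
    then have "g x = h x" if "x \<in> L" for x
      using induced_by_eq_if_three_points[OF line[OF L] _ _ pts _ _ _ that] eq by blast
    then show "g = h" by (rule arrow_eqI[OF gh])
  qed
  show "(\<lambda>g. (g p, g q, g r)) ` Hom \<L> L L \<subseteq> orbit \<L> L p \<times> orbit \<L> L q \<times> orbit \<L> L r"
    by (auto simp: Hom_def arrow_in_orbit)
  show "finite (orbit \<L> L p \<times> orbit \<L> L q \<times> orbit \<L> L r)" using fin by simp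
qed

lemma at_most_two_points_with_finite_orbit:
  assumes L: "L \<in> \<L>" and inf: "infinite (Hom \<L> L L)"
  shows "finite {p \<in> L. finite (orbit \<L> L p)}" "card {p \<in> L. finite (orbit \<L> L p)} \<le> 2"
proof -
  let ?F = "{p \<in> L. finite (orbit \<L> L p)}"
  have no_three: False if B: "B \<subseteq> ?F" "card B = 3" for B
  proof -
    obtain p q r where "B = {p, q, r}" "p \<noteq> q" "p \<noteq> r" "q \<noteq> r"
      using B(2) by (auto simp: card_3_iff)
    then show False
      using finite_Hom_if_three_finite_orbits[OF L, of p q r] inf B(1) by simp
  qed
  \<comment> \<open>Shown separately because an infinite set has \<open>card\<close> 0, so the bound
    below would not exclude it.\<close>
  show "finite ?F"
  proof (rule ccontr)
    assume "infinite ?F"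
    from infinite_arbitrarily_large[OF this, of 3] show False
      by (elim exE conjE) (rule no_three)
  qed
  show "card ?F \<le> 2"
  proof (rule ccontr)
    assume "\<not> card ?F \<le> 2"
    then have "3 \<le> card ?F" by linarith
    then show False by (rule obtain_subset_with_card_n) (rule no_three)
  qed
qed

text \<open>Following arrows from \<open>L\<close> to \<open>M\<close> by a fixed invertible arrow
  back to \<open>L\<close> embeds \<open>Hom \<L> L M\<close> into the finite vertex group. An orbit
  is then a union, over finitely many target lines, of finite sets of images.\<close>

lemma finite_orbit_if_finite_Hom:
  assumes L: "L \<in> \<L>" and fin: "finite (Hom \<L> L L)" and X: "X \<in> orbits \<L>"
  shows "finite X"
proof -
  have "finite (Hom \<L> L M)" if M: "M \<in> \<L>" for M
  proof -
    obtain k where k: "arrow \<L> M L k" using arrow_exists L M by blast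
    obtain k' where k': "\<And>p. p \<in> M \<Longrightarrow> k' (k p) = p" using arrow_inverseE[OF k] by metis
    show ?thesis
    proof (rule inj_on_finite[OF _ _ fin])
      show "(\<lambda>g. compose L k g) ` Hom \<L> L M \<subseteq> Hom \<L> L L"
        using k arrow.composition by (auto simp: Hom_def)
      show "inj_on (\<lambda>g. compose L k g) (Hom \<L> L M)"
      proof (rule inj_onI)
        fix g h assume "g \<in> Hom \<L> L M" "h \<in> Hom \<L> L M" and eq: "compose L k g = compose L k h"
        then have gh: "arrow \<L> L M g" "arrow \<L> L M h" by (auto simp: Hom_def)
        have "g x = h x" if x: "x \<in> L" for x
          using fun_cong[OF eq, of x] k' arrow_in[OF gh(1) x] arrow_in[OF gh(2) x]
          by (metis compose_eq x)
        then show "g = h" by (rule arrow_eqI[OF gh])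
      qed
    qed
  qed
  moreover obtain p where "X = orbit \<L> L p" using orbit_meets_line[OF X L] by blast
  ultimately show ?thesis using finite_lines by (simp add: orbit_def Setcompr_eq_image)
qed

text \<open>For a basis \<open>u\<close>, \<open>v\<close> of the underlying plane, the vectors
  \<open>u\<close>, \<open>v\<close> and \<open>u + v\<close> give three distinct points over any
  field.\<close>

lemma three_points_on_line:
  assumes "L \<in> proj_lines"
  obtains p q r where "p \<in> L" "q \<in> L" "r \<in> L" "p \<noteq> q" "p \<noteq> r" "q \<noteq> (r :: 'a point)"
proof -
  have dim: "vec.dim (vectors L) = 2" by (rule line_dim[OF assms])
  obtain B where B: "B \<subseteq> vectors L" "vec.independent B" "card B = 2"
    using vec.basis_exists[of "vectors L"] dim by metis
  then obtain u v where uv: "B = {u, v}" "u \<noteq> v" by (auto simp: card_2_iff)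
  have "vec.independent {u, v}" "vec.independent {v, u}"
    using B(2) uv(1) by (simp_all add: insert_commute)
  then have ind: "u \<notin> vec.span {v}" "v \<notin> vec.span {u}"
    using uv(2) by (simp_all add: vec.independent_insert split: if_splits)
  have nz: "u \<noteq> 0" "v \<noteq> 0" using ind vec.span_zero by metis+
  have "u + v \<noteq> 0" using ind(1) vec.span_neg[OF vec.span_base[of v "{v}"]]
    by (metis add_eq_0_iff2 insertI1)
  have sum: "u + v \<notin> vec.span {u}" "u + v \<notin> vec.span {v}"
    using ind vec.span_add_eq[of u "{u}" v] vec.span_add_eq2[of v "{v}" u]
    by (auto simp: vec.span_base)
  have "u + v \<in> vectors L"
    using B(1) uv line_subspace[OF assms] by (intro vec.subspace_add) auto
  then have "vec.span {u} \<in> L" "vec.span {v} \<in> L" "vec.span {u + v} \<in> L"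
    using nz \<open>u + v \<noteq> 0\<close> B(1) uv span_singleton_in_line_iff[OF assms] by auto
  moreover have "vec.span {u} \<noteq> vec.span {v}" "vec.span {u} \<noteq> vec.span {u + v}"
    "vec.span {v} \<noteq> vec.span {u + v}"
    using ind sum vec.span_base by (metis insertI1)+
  ultimately show thesis using that by blast
qed

text \<open>If all orbits were finite, three points of \<open>L\<close> would have finite orbits,
  and these would force a finite vertex group.\<close>

lemma infinite_orbit_if_infinite_Hom:
  assumes L: "L \<in> \<L>" and inf: "infinite (Hom \<L> L L)"
  shows "\<exists>X\<in>orbits \<L>. infinite X"
proof -
  obtain p q r where "p \<in> L" "q \<in> L" "r \<in> L" "p \<noteq> q" "p \<noteq> r" "q \<noteq> r"
    using three_points_on_line[OF line[OF L]] by blast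
  then show ?thesis
    using finite_Hom_if_three_finite_orbits[OF L, of p q r] inf L unfolding orbits_def by blast
qed

text \<open>The existence of an infinite orbit does not refer to a line, so it carries infiniteness
  from one vertex group to another without constructing an isomorphism.\<close>

lemma infinite_Hom_transfer:
  "\<lbrakk>L \<in> \<L>; M \<in> \<L>; infinite (Hom \<L> L L)\<rbrakk> \<Longrightarrow> infinite (Hom \<L> M M)"
  using infinite_orbit_if_infinite_Hom finite_orbit_if_finite_Hom by blast

section \<open>Rigidity of points with a finite orbit\<close>

lemma proj_map_independent_of_third_line:
  assumes L: "L1 \<in> \<L>" "L2 \<in> \<L>" "L3 \<in> \<L>" "L4 \<in> \<L>" and dist: "distinct [L1, L2, L3, L4]"
    and p: "p \<in> L1" and fin: "finite (orbit \<L> L1 p)" and inf: "infinite (Hom \<L> L1 L1)"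
  shows "proj_map L1 L2 L4 p = proj_map L1 L2 L3 p"
proof -
  have ne: "L1 \<noteq> L2" "L1 \<noteq> L3" "L1 \<noteq> L4" "L2 \<noteq> L3" "L2 \<noteq> L4" "L3 \<noteq> L4"
    "L2 \<noteq> L1" "L3 \<noteq> L1" "L4 \<noteq> L1" "L3 \<noteq> L2" "L4 \<noteq> L2" "L4 \<noteq> L3" using dist by auto
  obtain v where v: "v \<noteq> 0" "v \<in> vectors L1" "p = vec.span {v}"
    by (rule line_pointE[OF line[OF L(1)] p])
  obtain x y where xy: "x \<in> vectors L2" "y \<in> vectors L4" "v = x + y"
    by (rule decomposition[OF L(2,4) ne(5)])
  obtain a c where ac: "a \<in> vectors L1" "c \<in> vectors L3" "x = a + c"
    by (rule decomposition[OF L(1,3) ne(2)])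
  obtain a' c' where ac': "a' \<in> vectors L1" "c' \<in> vectors L3" "y = a' + c'"
    by (rule decomposition[OF L(1,3) ne(2)])
  have sub: "vec.subspace (vectors L1)" "vec.subspace (vectors L3)" using L line line_subspace by blast+
  \<comment> \<open>Since \<open>v\<close> already lies in \<open>vectors L1\<close>, its component
    along \<open>L3\<close> is 0, so adding the splittings of \<open>x\<close> and \<open>y\<close>
    must reproduce \<open>v\<close> from the \<open>L1\<close>-parts.\<close>
  have sum: "v = a + a'"
  proof (rule decomposition_unique(1)[OF L(1,3) ne(2) v(2)])
    show "0 \<in> vectors L3" using sub(2) by (rule vec.subspace_0)
    show "a + a' \<in> vectors L1" using sub(1) ac(1) ac'(1) by (rule vec.subspace_add)
    show "c + c' \<in> vectors L3" using sub(2) ac(2) ac'(2) by (rule vec.subspace_add)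
    show "v + 0 = a + a' + (c + c')" using xy(3) ac(3) ac'(3) by simp
  qed
  \<comment> \<open>These four facts exhibit the spans of \<open>a\<close> and \<open>a'\<close> as
    images of \<open>p\<close> under the detours through \<open>L2\<close> and \<open>L4\<close>;
    their nonvanishing parts make all four spans genuine points.\<close>
  note x = proj_map_span[OF L(1,2,4) ne(1,5,3) v(1,2) xy(3,1,2)]
  have "v = y + x" using xy(3) by (simp add: add.commute)
  note y = proj_map_span[OF L(1,4,2) ne(3,11,1) v(1,2) this xy(2,1)]
  note a = proj_map_span[OF L(2,1,3) ne(7,2,4) x(1) xy(1) ac(3,1,2)]
  note a' = proj_map_span[OF L(4,1,3) ne(9,2,12) y(1) xy(2) ac'(3,1,2)]
  have fixed: "vec.span {a} \<in> L1" "vec.span {a'} \<in> L1"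
    using a(1) a'(1) ac(1) ac'(1) span_singleton_in_line_iff[OF line[OF L(1)]] by blast+
  have step: "orbit \<L> M (proj_map N M K r) = orbit \<L> N r"
    if "N \<in> \<L>" "M \<in> \<L>" "K \<in> \<L>" "N \<noteq> M" "M \<noteq> K" "N \<noteq> K" "r \<in> N" for N M K r
    using that by (intro orbit_eq arrow.generator)
  have "vec.span {x} \<in> L2" "vec.span {y} \<in> L4"
    using x(1) y(1) xy span_singleton_in_line_iff L line by blast+
  then have orb: "orbit \<L> L1 (vec.span {a}) = orbit \<L> L1 p"
    "orbit \<L> L1 (vec.span {a'}) = orbit \<L> L1 p"
    using step[OF L(2,1,3) ne(7,2,4), of "vec.span {x}"] step[OF L(1,2,4) ne(1,5,3) p]
      step[OF L(4,1,3) ne(9,2,12), of "vec.span {y}"] step[OF L(1,4,2) ne(3,11,1) p]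
      x(2) y(2) a(2) a'(2) v(3) by simp_all
  \<comment> \<open>If this failed, \<open>v = a + a'\<close> would make \<open>p\<close> and the
    spans of \<open>a\<close> and \<open>a'\<close> pairwise distinct: any coincidence makes
    \<open>a\<close> and \<open>v\<close> proportional. Three points of \<open>L1\<close> with the
    same finite orbit contradict the infinite vertex group.\<close>
  have "vec.span {a} = p"
  proof (rule ccontr)
    assume np: "vec.span {a} \<noteq> p"
    have "vec.span {a'} \<noteq> p"
    proof
      assume "vec.span {a'} = p"
      then obtain k where "a' = k *s v" using v(3) span_singleton_eqE by metis
      then have "a = (1 - k) *s v" using sum by (simp add: vec_eq_iff algebra_simps)
      then show False using np v(3) a(1) span_singleton_eqI by metis
    qed
    moreover have "vec.span {a'} \<noteq> vec.span {a}"
    proof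
      assume "vec.span {a'} = vec.span {a}"
      then obtain k where "a' = k *s a" using span_singleton_eqE by metis
      then have "v = (1 + k) *s a" using sum by (simp add: vec_eq_iff algebra_simps)
      then show False using np v(1,3) span_singleton_eqI by metis
    qed
    ultimately show False
      using finite_Hom_if_three_finite_orbits[OF L(1) fixed p] np orb fin inf by metis
  qed
  then obtain k where k: "a = k *s v" using v(3) span_singleton_eqE by metis
  then have "k \<noteq> 0" using a(1) by auto
  \<comment> \<open>Solving \<open>x = k *s v + c\<close> for \<open>v\<close> splits it along
    \<open>L2\<close> and \<open>L3\<close> with an \<open>L2\<close>-part proportional to
    \<open>x\<close>, which is the \<open>L2\<close>-part along \<open>L4\<close>.\<close>
  then have "v = inverse k *s x + (- inverse k) *s c"
    using k ac(3) by (simp add: vec_eq_iff algebra_simps)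
  moreover have "inverse k *s x \<in> vectors L2" "(- inverse k) *s c \<in> vectors L3"
    using xy(1) ac(2) L line line_subspace vec.subspace_scale by blast+
  ultimately have "inverse k *s x \<noteq> 0"
    "proj_map L1 L2 L3 p = vec.span {inverse k *s x}"
    using proj_map_span[OF L(1,2,3) ne(1,4,2) v(1,2)] v(3) by blast+
  then show ?thesis using x(2) v(3) span_singleton_eqI by metis
qed

section \<open>Transversals and the orbits on them\<close>

lemma transversal_notin:
  assumes "transversal \<L> T"
  shows "T \<notin> \<L>"
proof
  assume T: "T \<in> \<L>"
  \<comment> \<open>A transversal belonging to the configuration would meet this second line,
    against skewness.\<close>
  obtain M where "M \<in> \<L>" "M \<notin> {T}" using another_line[of "{T}"] by auto
  then show False using assms T lines_disjoint by (fastforce simp: transversal_def)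
qed

lemma transversal_meets_once:
  assumes T: "transversal \<L> T" and L: "L \<in> \<L>" and "p \<in> T" "p \<in> L" "q \<in> T" "q \<in> L"
  shows "p = q"
proof (rule ccontr)
  assume "p \<noteq> q"
  moreover have "T \<in> proj_lines" using T by (simp add: transversal_def)
  ultimately have "L = T"
    using line_eq_if_two_common_points[OF line[OF L], of p q T] assms(3-6) by simp
  then show False using transversal_notin[OF T] L by simp
qed

text \<open>The points of \<open>T\<close> on \<open>Lj\<close> and \<open>Lk\<close> are distinct
  and span \<open>T\<close>. Writing \<open>v\<close> in terms of them is already the decomposition
  along \<open>Lj\<close> and \<open>Lk\<close>, so the image is the point of \<open>T\<close> on
  \<open>Lj\<close>.\<close>

lemma proj_map_transversal:
  assumes T: "transversal \<L> T"
    and L: "Li \<in> \<L>" "Lj \<in> \<L>" "Lk \<in> \<L>" "Li \<noteq> Lj" "Lj \<noteq> Lk" "Li \<noteq> Lk"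
    and p: "p \<in> Li" "p \<in> T"
  shows "proj_map Li Lj Lk p \<in> T"
proof -
  have Tl: "T \<in> proj_lines" using T by (simp add: transversal_def)
  obtain q r where q: "q \<in> T" "q \<in> Lj" and r: "r \<in> T" "r \<in> Lk"
    using T L unfolding transversal_def by blast
  obtain v where v: "v \<noteq> 0" "v \<in> vectors Li" "p = vec.span {v}" by (rule line_pointE[OF line[OF L(1)] p(1)])
  obtain x where x: "x \<noteq> 0" "x \<in> vectors Lj" "q = vec.span {x}" by (rule line_pointE[OF line[OF L(2)] q(2)])
  obtain y where y: "y \<noteq> 0" "y \<in> vectors Lk" "r = vec.span {y}" by (rule line_pointE[OF line[OF L(3)] r(2)])
  have "q \<noteq> r" using q r L lines_disjoint by blast
  moreover have "v \<in> vectors T" "x \<in> vectors T" "y \<in> vectors T"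
    using v(1,3) x(1,3) y(1,3) p(2) q(1) r(1) span_singleton_in_line_iff[OF Tl] by blast+
  ultimately obtain a b where "v = a *s x + b *s y"
    using line_spanned_by_two_points[OF Tl, of x y v] x(1,3) y(1,3) by metis
  moreover have "a *s x \<in> vectors Lj" "b *s y \<in> vectors Lk"
    using x(2) y(2) L line line_subspace vec.subspace_scale by blast+
  ultimately have "a *s x \<noteq> 0" "proj_map Li Lj Lk p = vec.span {a *s x}"
    using proj_map_span[OF L v(1,2)] v(3) by blast+
  then show ?thesis using x(3) q(1) span_singleton_eqI by metis
qed

lemma arrow_transversal:
  assumes "arrow \<L> L M g" and "transversal \<L> T" and "p \<in> L" "p \<in> T"
  shows "g p \<in> T"
  using assms
proof (induction arbitrary: p)
  case (generator Li Lj Lk)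
  then show ?case by (intro proj_map_transversal)
qed (auto simp: compose_eq arrow_in)

text \<open>The vertex groups are assumed infinite at every line because the line carrying a
  representative of \<open>X\<close> is only obtained inside the proof.\<close>

lemma finite_orbit_transversal:
  assumes X: "X \<in> orbits \<L>" "finite X" and inf: "\<And>L. L \<in> \<L> \<Longrightarrow> infinite (Hom \<L> L L)"
  obtains T where "transversal \<L> T" "X = T \<inter> \<Union>\<L>"
proof -
  obtain L p where L: "L \<in> \<L>" "p \<in> L" "X = orbit \<L> L p" using X by (auto simp: orbits_def)
  obtain J where J: "J \<in> \<L>" "J \<noteq> L" using another_line[of "{L}"] by auto
  obtain K where K: "K \<in> \<L>" "K \<noteq> L" "K \<noteq> J"
    using another_line[of "{L, J}"] J(2) by auto
  obtain v where v: "v \<noteq> 0" "v \<in> vectors L" "p = vec.span {v}" by (rule line_pointE[OF line[OF L(1)] L(2)])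
  obtain w u where wu: "w \<in> vectors J" "u \<in> vectors K" "v = w + u"
    by (rule decomposition[OF J(1) K(1) K(3)[symmetric]])
  note w = proj_map_span[OF L(1) J(1) K(1) J(2)[symmetric] K(3)[symmetric] K(2)[symmetric]
      v(1,2) wu(3,1,2)]
  have wJ: "vec.span {w} \<in> J" using w(1) wu(1) J line span_singleton_in_line_iff by blast
  then have "vec.span {v} \<noteq> vec.span {w}" using lines_disjoint[OF L(1) J(1) L(2)] J(2) v(3) by metis
  \<comment> \<open>The candidate transversal joins \<open>p\<close> to its image on
    \<open>J\<close>; only its meeting with the remaining lines needs an argument.\<close>
  then obtain T where T: "T \<in> proj_lines" "p \<in> T" "vec.span {w} \<in> T" "vectors T = vec.span {v, w}"
    using line_through_two_points[OF v(1) w(1)] v(3) by metis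
  have in_X: "g p \<in> X" if "arrow \<L> L M g" for M g
    using that L(3) arrow_in_orbit by blast
  have p_in_X: "p \<in> X" using in_X[OF arrow.identity[OF L(1)]] L(2) by simp
  have meet: "\<exists>q. q \<in> X \<and> q \<in> T \<and> q \<in> M" if M: "M \<in> \<L>" for M
  proof -
    consider "M = L" | "M = J" | "M \<noteq> L" "M \<noteq> J" by blast
    then show ?thesis
    proof cases
      case 1
      then show ?thesis using p_in_X T(2) L(2) by blast
    next
      case 2
      have "arrow \<L> L J (proj_map L J K)" using L J K by (intro arrow.generator) auto
      then have "vec.span {w} \<in> X" using in_X w(2) v(3) by metis
      then show ?thesis using 2 wJ T(3) by blast
    next
      case 3
      obtain a b where ab: "b \<in> vectors M" "a \<in> vectors J" "v = b + a"
        by (rule decomposition[OF M J(1) 3(2)])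
      have "v = a + b" using ab(3) by (simp add: add.commute)
      note a = proj_map_span[OF L(1) J(1) M J(2)[symmetric] 3(2)[symmetric] 3(1)[symmetric]
          v(1,2) this ab(2,1)]
      note b = proj_map_span[OF L(1) M J(1) 3(1)[symmetric] 3(2) J(2)[symmetric]
          v(1,2) ab(3,1,2)]
      \<comment> \<open>Independence of the third line applies to four distinct lines; for
        \<open>M = K\<close> the equation is trivial.\<close>
      have "proj_map L J M p = proj_map L J K p"
      proof (cases "M = K")
        case False
        then show ?thesis
          using proj_map_independent_of_third_line[OF L(1) J(1) K(1) M _ L(2)] L(3) X(2)
            inf[OF L(1)] J K 3 by auto
      qed simp
      then have "vec.span {a} = vec.span {w}" using a(2) w(2) v(3) by simp
      then obtain c where "a = c *s w" using span_singleton_eqE by metis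
      \<comment> \<open>The \<open>J\<close>-part of \<open>v\<close> along \<open>M\<close> is now
        a multiple of \<open>w\<close>, so the complementary \<open>M\<close>-part \<open>b\<close>
        lies in the plane of \<open>T\<close>. Its span is also an image of \<open>p\<close>, hence
        a point of \<open>X\<close>.\<close>
      then have "b = v - c *s w" using ab(3) by simp
      then have "b \<in> vectors T" unfolding T(4)
        by (auto intro!: vec.span_diff vec.span_scale intro: vec.span_base)
      then have "vec.span {b} \<in> T" "vec.span {b} \<in> M"
        using b(1) ab(1) span_singleton_in_line_iff T(1) M line by blast+
      moreover have "arrow \<L> L M (proj_map L M J)" using L J M 3 by (intro arrow.generator) auto
      then have "vec.span {b} \<in> X" using in_X b(2) v(3) by metis
      ultimately show ?thesis by blast
    qed
  qed
  then have trans: "transversal \<L> T" using T(1) unfolding transversal_def by blast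
  have "X = T \<inter> \<Union>\<L>"
  proof
    show "X \<subseteq> T \<inter> \<Union>\<L>"
      using L T(2) arrow_transversal[OF _ trans] arrow_in arrow_lines
      by (fastforce simp: in_orbit_iff)
    \<comment> \<open>Each line carries a point common to \<open>T\<close> and \<open>X\<close>, and
      \<open>T\<close> has no other point on that line.\<close>
    show "T \<inter> \<Union>\<L> \<subseteq> X" using meet transversal_meets_once[OF trans] by blast
  qed
  with trans show thesis by (rule that)
qed

text \<open>Sending each line to its meeting point with \<open>T\<close> is a bijection onto the
  intersection: injective by skewness, onto because \<open>T\<close> meets each line once.\<close>

lemma card_transversal:
  assumes T: "transversal \<L> T"
  shows "card (T \<inter> \<Union>\<L>) = card \<L>"
proof -
  obtain c where c: "\<And>M. M \<in> \<L> \<Longrightarrow> c M \<in> T \<and> c M \<in> M"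
    using T unfolding transversal_def by (metis disjoint_iff)
  have "inj_on c \<L>" using c lines_disjoint by (metis inj_onI)
  moreover have "T \<inter> \<Union>\<L> = c ` \<L>" using c transversal_meets_once[OF T] by blast
  ultimately show ?thesis by (simp add: card_image)
qed

end

theorem theorem2p1p6:
  fixes \<L> :: "'a::alg_closed_field point set set" and s :: nat
  assumes "finite \<L>" and "card \<L> = s" and "s \<ge> 3" and "skew_lines \<L>"
  shows "\<forall>L\<in>\<L>.
    ((\<exists>X\<in>orbits \<L>. infinite X) \<longleftrightarrow> infinite (carrier (vertex_group \<L> L))) \<and>
    (infinite (carrier (vertex_group \<L> L)) \<longrightarrow>
      finite {X \<in> orbits \<L>. finite X} \<and> card {X \<in> orbits \<L>. finite X} \<le> 2 \<and>
      (\<forall>X\<in>orbits \<L>. finite X \<longrightarrow>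
         card X = s \<and> (\<exists>T. transversal \<L> T \<and> X = T \<inter> \<Union> \<L>)))"
proof
  interpret skew_line_configuration \<L> using assms by unfold_locales simp_all
  fix L assume L: "L \<in> \<L>"
  have carrier: "carrier (vertex_group \<L> L) = Hom \<L> L L" by (simp add: vertex_group_def)
  show "((\<exists>X\<in>orbits \<L>. infinite X) \<longleftrightarrow> infinite (carrier (vertex_group \<L> L))) \<and>
    (infinite (carrier (vertex_group \<L> L)) \<longrightarrow>
      finite {X \<in> orbits \<L>. finite X} \<and> card {X \<in> orbits \<L>. finite X} \<le> 2 \<and>
      (\<forall>X\<in>orbits \<L>. finite X \<longrightarrow>
         card X = s \<and> (\<exists>T. transversal \<L> T \<and> X = T \<inter> \<Union> \<L>)))"
    unfolding carrier
  proof (intro conjI impI ballI)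
    show "(\<exists>X\<in>orbits \<L>. infinite X) \<longleftrightarrow> infinite (Hom \<L> L L)"
      using L finite_orbit_if_finite_Hom infinite_orbit_if_infinite_Hom by blast
  next
    assume inf: "infinite (Hom \<L> L L)"
    let ?F = "{p \<in> L. finite (orbit \<L> L p)}"
    \<comment> \<open>Every orbit is represented on \<open>L\<close>, so the finite ones are images
      of the at most two points of \<open>L\<close> with finite orbit.\<close>
    have sub: "{X \<in> orbits \<L>. finite X} \<subseteq> orbit \<L> L ` ?F"
      using orbit_meets_line[OF _ L] by blast
    note F = at_most_two_points_with_finite_orbit[OF L inf]
    show "finite {X \<in> orbits \<L>. finite X}"
      using sub F(1) finite_surj by blast
    show "card {X \<in> orbits \<L>. finite X} \<le> 2"
      using surj_card_le[OF F(1) sub] F(2) by linarith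
  next
    fix X assume inf: "infinite (Hom \<L> L L)" and X: "X \<in> orbits \<L>" "finite X"
    \<comment> \<open>Infiniteness at \<open>L\<close> is first transferred to every line, as the
      construction of the transversal requires.\<close>
    obtain T where T: "transversal \<L> T" "X = T \<inter> \<Union>\<L>"
      using finite_orbit_transversal[OF X] infinite_Hom_transfer[OF L _ inf] by blast
    then show "card X = s" using card_transversal assms(2) by simp
    show "\<exists>T. transversal \<L> T \<and> X = T \<inter> \<Union>\<L>" using T by blast
  qed
qed

end
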